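(* Let $\{\mathcal{T}(t)\}_{t\ge 0}$ be the symmetric telegraph process with speed $c>0$ and rate $\lambda>0$, and let $t>0$. For every integer $k\ge 0$ and $0<\beta<ct$, $$P\Bigl\{ \max_{0\le s\le t} \mathcal{T}(s) \in d\beta \,\Big|\, V(0) = -c,\ N(t) = 2k+1\Bigr\} = \frac{2k+1}{2k+2}\, P\Bigl\{ \max_{0\le s\le t} \mathcal{T}(s) \in d\beta \,\Big|\, V(0) = -c,\ N(t) = 2k\Bigr\}$$ $$+\ \frac{1}{2k+2}\,P\Bigl\{ \max_{0\le s\le t} \mathcal{T}(s) \in d\beta \,\Big|\, V(0) = c,\ N(t) = 2k+1\Bigr\} .$$
   Context: Let $c>0$, $\lambda>0$. Let $V(0)$ be a random variable with $P\{V(0)=c\}=P\{V(0)=-c\}=\tfrac12$ and let $\{N(t)\}_{t\ge0}$ be a homogeneous Poisson process with rate $\lambda$, independent of $V(0)$. The symmetric telegraph process is $\mathcal{T}(t)=\int_0^t V(0)(-1)^{N(s)}\,ds$, $t\ge 0$ (so $\mathcal{T}(0)=0$). The displayed identity is an identity between the restrictions to Borel subsets of the open interval $(0,ct)$ of the conditional laws involved (equivalently, between their densities there). *)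

theory Defs
  imports "HOL-Probability.Probability"
begin

text \<open>
  Homogeneous Poisson process indexed by the times \<open>t \<ge> 0\<close> (values at negative indices are
  irrelevant).  Paths are nondecreasing and right-continuous at every sample point, so the
  truncated subtraction in the increments is never an actual truncation.
\<close>

definition poisson_process :: "'a measure \<Rightarrow> real \<Rightarrow> (real \<Rightarrow> 'a \<Rightarrow> nat) \<Rightarrow> bool" where
  "poisson_process M rate N \<longleftrightarrow>
     (\<forall>t\<ge>0. N t \<in> M \<rightarrow>\<^sub>M count_space UNIV) \<and>
     (\<forall>\<omega>\<in>space M. N 0 \<omega> = 0) \<and>
     (\<forall>\<omega>\<in>space M. mono_on {0..} (\<lambda>s. N s \<omega>)) \<and>
     (\<forall>\<omega>\<in>space M. \<forall>s\<ge>0. continuous (at_right s) (\<lambda>u. N u \<omega>)) \<and>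
     (\<forall>(n::nat) (\<tau>::nat \<Rightarrow> real). 0 \<le> \<tau> 0 \<and> (\<forall>i<n. \<tau> i < \<tau> (Suc i)) \<longrightarrow>
        prob_space.indep_vars M (\<lambda>_. count_space UNIV)
          (\<lambda>i \<omega>. N (\<tau> (Suc i)) \<omega> - N (\<tau> i) \<omega>) {..<n}) \<and>
     (\<forall>s t. 0 \<le> s \<and> s < t \<longrightarrow>
        distr M (count_space UNIV) (\<lambda>\<omega>. N t \<omega> - N s \<omega>) = measure_pmf (poisson_pmf (rate * (t - s))))"

text \<open>
  Independence of \<open>V\<close> and \<open>N\<close> is independence of the generated sigma-algebras, with the whole
  process \<open>N\<close> viewed as one random element of the product space over \<open>{0..}\<close>.  The library's
  \<open>indep_var\<close> is not applicable, as it requires both variables to have the same value type.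
\<close>

definition telegraph_data ::
    "'a measure \<Rightarrow> real \<Rightarrow> real \<Rightarrow> ('a \<Rightarrow> real) \<Rightarrow> (real \<Rightarrow> 'a \<Rightarrow> nat) \<Rightarrow> bool" where
  "telegraph_data M c rate V N \<longleftrightarrow>
     V \<in> borel_measurable M \<and>
     \<P>(\<omega> in M. V \<omega> = c) = 1 / 2 \<and>
     \<P>(\<omega> in M. V \<omega> = - c) = 1 / 2 \<and>
     poisson_process M rate N \<and>
     prob_space.indep_set M
       (sets (vimage_algebra (space M) V borel))
       (sets (vimage_algebra (space M) (\<lambda>\<omega>. \<lambda>s\<in>{0..}. N s \<omega>) (PiM {0..} (\<lambda>_. count_space UNIV))))"

definition telegraph :: "('a \<Rightarrow> real) \<Rightarrow> (real \<Rightarrow> 'a \<Rightarrow> nat) \<Rightarrow> real \<Rightarrow> 'a \<Rightarrow> real" where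
  "telegraph V N t \<omega> = (LBINT s:{0..t}. V \<omega> * (- 1) ^ N s \<omega>)"

text \<open>
  The paths of the telegraph process are Lipschitz continuous, so this supremum over a compact
  interval is attained: it is the maximum.
\<close>

definition telegraph_max :: "('a \<Rightarrow> real) \<Rightarrow> (real \<Rightarrow> 'a \<Rightarrow> nat) \<Rightarrow> real \<Rightarrow> 'a \<Rightarrow> real" where
  "telegraph_max V N t \<omega> = (SUP s\<in>{0..t}. telegraph V N s \<omega>)"

end

(*
  Cut [0,t] into r cells of length h. Given that no cell contains two jumps, the path is a walk with
  steps +-ch coded by the 0-1 word of its jumps, and all words with n jumps are equally likely. The
  number of words whose walk reaches the level r+1-2q obeys a Pascal-type recursion in the light-cone
  coordinates p = r-q and q, solved by a sum of binomial products (p choose i)(q choose n-i) with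
  weights 0, 1, 2. The discretised maximum differs from the true one by O(h), so as h tends to 0 the
  tails of the maximum become the same sums of products x^i/i! y^(n-i)/(n-i)! with x, y = (t +- b/c)/2;
  for these the recursion in k is a comparison of coefficients.
*)
theory Submission
  imports Defs
begin

section \<open>Words of jumps and discrete maxima\<close>

text \<open>The light-cone coordinates fit because an upward step takes one unit from p, a downward
  step one unit from q, and either shortens the word by one. The boundaries are the diagonal p = q,
  where a walk that starts upward is at its level after one step, and q = 0, where a walk that
  starts downward never gets there. A jump reverses the direction, so the counts for the two initial
  directions have to be found together; their solutions differ only by an offset in the argument of
  \<open>weight\<close>. The grid error of a path grows with its number of jumps, so n stays fixed
  throughout; the error then costs a bounded change of q, which the scaling erases. The two
  coefficients of the recursion add up to 1, so it equates a law with a mixture of two laws, and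
  such an identity can be tested on tails.\<close>

definition reaches :: "int \<Rightarrow> int \<Rightarrow> bool list \<Rightarrow> bool" where
  "reaches \<sigma> b es \<longleftrightarrow>
     (\<exists>i\<le>Suc (length es). b \<le> (\<Sum>l<i. \<sigma> * (- 1) ^ count_list (take l es) True))"

definition jump_lists :: "nat \<Rightarrow> nat \<Rightarrow> (bool list \<Rightarrow> bool) \<Rightarrow> bool list set" where
  "jump_lists r n P = {es. length es = r \<and> count_list es True = n \<and> P es}"

definition weight :: "int \<Rightarrow> real" where
  "weight d = 1 + sgn (real_of_int d)"

text \<open>The offset \<open>s\<close> is 0 for walks that start upward and 1 for those that start
  downward. Keeping \<open>f\<close> and \<open>g\<close> abstract lets the same expression serve
  for binomial coefficients and for their limits x^i/i!.\<close>

definition wsum :: "int \<Rightarrow> nat \<Rightarrow> (nat \<Rightarrow> real) \<Rightarrow> (nat \<Rightarrow> real) \<Rightarrow> real" where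
  "wsum s n f g = (\<Sum>i\<le>n. weight (int n - 2 * int i - s) * f i * g (n - i))"

lemma ex_le_Suc_shift: "(\<exists>i\<le>Suc m. P i) \<longleftrightarrow> P 0 \<or> (\<exists>i\<le>m. P (Suc i))"
  by (metis Suc_le_mono le0 not0_implies_Suc)

text \<open>Step 0 always goes in the direction \<open>\<sigma>\<close>, and the letter
  \<open>e\<close> decides the direction of step 1. This is why a word of length r drives r + 1
  steps: its last letter still has to move the walk.\<close>

lemma reaches_Cons:
  "reaches \<sigma> b (e # es) \<longleftrightarrow> b \<le> 0 \<or> reaches (if e then - \<sigma> else \<sigma>) (b - \<sigma>) es"
proof -
  have *: "(\<Sum>l<Suc i. \<sigma> * (- 1) ^ count_list (take l (e # es)) True) =
      \<sigma> + (\<Sum>l<i. (if e then - \<sigma> else \<sigma>) * (- 1) ^ count_list (take l es) True)" for i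
    by (subst sum.lessThan_Suc_shift) auto
  have "reaches \<sigma> b (e # es) \<longleftrightarrow> b \<le> 0 \<or>
      (\<exists>i\<le>Suc (length es). b \<le> (\<Sum>l<Suc i. \<sigma> * (- 1) ^ count_list (take l (e # es)) True))"
    unfolding reaches_def list.size add_Suc_right add_0_right
    by (subst ex_le_Suc_shift) simp
  then show ?thesis
    unfolding * unfolding reaches_def by (simp add: diff_le_eq add.commute)
qed

section \<open>Counting words by their first letter\<close>

lemma finite_jump_lists: "finite (jump_lists r n P)"
  by (rule finite_subset[OF _ finite_lists_length_eq[of UNIV r]]) (auto simp: jump_lists_def)

lemma card_jump_lists_Suc_Suc:
  "card (jump_lists (Suc r) (Suc n) P) =
     card (jump_lists r (Suc n) (\<lambda>es. P (False # es))) + card (jump_lists r n (\<lambda>es. P (True # es)))"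
proof -
  have "jump_lists (Suc r) (Suc n) P = Cons False ` jump_lists r (Suc n) (\<lambda>es. P (False # es)) \<union>
      Cons True ` jump_lists r n (\<lambda>es. P (True # es))"
    by (auto simp: jump_lists_def length_Suc_conv image_iff split: if_splits)
  also have "card \<dots> = card (Cons False ` jump_lists r (Suc n) (\<lambda>es. P (False # es))) +
      card (Cons True ` jump_lists r n (\<lambda>es. P (True # es)))"
    by (rule card_Un_disjoint) (auto simp: finite_jump_lists)
  finally show ?thesis
    by (simp add: card_image)
qed

lemma card_jump_lists_Suc_0:
  "card (jump_lists (Suc r) 0 P) = card (jump_lists r 0 (\<lambda>es. P (False # es)))"
proof -
  have "jump_lists (Suc r) 0 P = Cons False ` jump_lists r 0 (\<lambda>es. P (False # es))"
    by (auto simp: jump_lists_def length_Suc_conv image_iff split: if_splits)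
  then show ?thesis
    by (simp add: card_image)
qed

lemma card_jump_lists_True: "card (jump_lists r n (\<lambda>_. True)) = r choose n"
proof (induction r arbitrary: n)
  case 0
  have "jump_lists 0 n (\<lambda>_. True) = (if n = 0 then {[]} else {})"
    by (auto simp: jump_lists_def)
  then show ?case by simp
next
  case (Suc r)
  then show ?case
    by (cases n) (simp_all add: card_jump_lists_Suc_Suc card_jump_lists_Suc_0)
qed

section \<open>Words whose walk reaches a level, and weighted binomial sums\<close>

lemma reaches_one: "reaches 1 1 = (\<lambda>_. True)"
  unfolding reaches_def by (intro ext eqTrueI exI[of _ 1]) simp

text \<open>The first step goes down, so the r steps that remain lift the walk to r - 1 at
  most.\<close>

lemma not_reaches_down:
  "\<not> reaches (- 1) (int (length es) + 1) es"
proof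
  assume "reaches (- 1) (int (length es) + 1) es"
  then obtain i where i: "i \<le> Suc (length es)"
    and le: "int (length es) + 1 \<le> (\<Sum>l<i. - 1 * (- 1) ^ count_list (take l es) True)"
    unfolding reaches_def by auto
  have "i \<noteq> 0" using le by (intro notI) simp
  then obtain j where j: "i = Suc j" by (cases i) auto
  have "(\<Sum>l<i. - 1 * (- 1) ^ count_list (take l es) True) =
      - 1 + (\<Sum>l<j. - 1 * (- 1) ^ count_list (take (Suc l) es) True :: int)"
    unfolding j by (subst sum.lessThan_Suc_shift) simp
  also have "\<dots> \<le> - 1 + (\<Sum>l<j. 1)"
    by (intro add_left_mono sum_mono) (simp add: minus_one_power_iff)
  finally show False using le i j by simp
qed

text \<open>Pascal's rule, with i shifted by one in its second part. Together with the drop of n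
  this turns offset 0 into offset 1, just as a jump turns an upward walk into a downward one. In the
  second factor i stays and only n drops, which turns offset 1 back into 0.\<close>

lemma wsum_binomial_Suc_left:
  "wsum 0 (Suc n) (\<lambda>i. real (Suc p choose i)) g =
     wsum 0 (Suc n) (\<lambda>i. real (p choose i)) g + wsum 1 n (\<lambda>i. real (p choose i)) g"
  unfolding wsum_def sum.atMost_Suc_shift
  by (simp add: algebra_simps sum.distrib)

lemma wsum_binomial_Suc_right:
  "wsum 1 (Suc n) f (\<lambda>i. real (Suc q choose i)) =
     wsum 1 (Suc n) f (\<lambda>i. real (q choose i)) + wsum 0 n f (\<lambda>i. real (q choose i))"
proof -
  have *: "(\<Sum>i\<le>n. weight (int (Suc n) - 2 * int i - 1) * f i * real (Suc q choose (Suc n - i)))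
     = (\<Sum>i\<le>n. weight (int (Suc n) - 2 * int i - 1) * f i * real (q choose (Suc n - i)))
     + (\<Sum>i\<le>n. weight (int n - 2 * int i - 0) * f i * real (q choose (n - i)))"
    unfolding sum.distrib[symmetric]
    by (intro sum.cong refl) (simp add: Suc_diff_le algebra_simps)
  show ?thesis
    unfolding wsum_def sum.atMost_Suc * by simp
qed

text \<open>On the diagonal the weights of the terms \<open>i\<close> and \<open>n - i\<close> add up to 2.\<close>

lemma wsum_0_symmetric: "wsum 0 n f f = (\<Sum>i\<le>n. f i * f (n - i))"
proof -
  let ?h = "\<lambda>i. sgn (real_of_int (int n - 2 * int i)) * f i * f (n - i)"
  have "(\<Sum>i\<le>n. ?h i) = (\<Sum>i\<le>n. ?h (n - i))"
    using sum.nat_diff_reindex[of ?h "Suc n"] by (simp add: lessThan_Suc_atMost)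
  also have "\<dots> = (\<Sum>i\<le>n. - ?h i)"
    by (intro sum.cong refl) (auto simp: sgn_if of_nat_diff)
  finally have "(\<Sum>i\<le>n. ?h i) = 0" by (simp add: sum_negf)
  then show ?thesis
    by (simp add: wsum_def weight_def distrib_right sum.distrib)
qed

text \<open>Peeling off the first step replaces the level of (p, q) by that of (p - 1, q) or (p, q -
  1), and Pascal's rule in the matching factor does the same to the sums. By
  \<open>q \<le> p\<close> the level is at least 1, so the starting point itself never
  counts.\<close>

lemma card_jump_lists_reaches:
  assumes "q \<le> p"
  shows "real (card (jump_lists (p + q) n (reaches 1 (int p + 1 - int q)))) =
           wsum 0 n (\<lambda>i. real (p choose i)) (\<lambda>j. real (q choose j))
      \<and> real (card (jump_lists (p + q) n (reaches (- 1) (int p + 1 - int q)))) =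
           wsum 1 n (\<lambda>i. real (p choose i)) (\<lambda>j. real (q choose j))"
  using assms
proof (induction r \<equiv> "p + q" arbitrary: p q n rule: less_induct)
  case less
  show ?case
  proof (rule conjI)
    show "real (card (jump_lists (p + q) n (reaches 1 (int p + 1 - int q)))) =
            wsum 0 n (\<lambda>i. real (p choose i)) (\<lambda>j. real (q choose j))"
    proof (cases "p = q")
      case True
      \<comment> \<open>Here every word counts, so the weighted sum must be the full binomial
        coefficient: the weights average to 1 by symmetry, and Vandermonde gives the rest.\<close>
      have "(\<Sum>i\<le>n. real (q choose i) * real (q choose (n - i))) = real (p + q choose n)"
        using vandermonde[of q q n] by (simp add: True flip: of_nat_mult of_nat_sum)
      then show ?thesis
        using True by (simp add: reaches_one card_jump_lists_True wsum_0_symmetric)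
    next
      case False
      then obtain p' where p: "p = Suc p'" and q: "q \<le> p'"
        using less.prems by (cases p) auto
      have step: "reaches 1 (int p + 1 - int q) (e # es) \<longleftrightarrow>
          reaches (if e then - 1 else 1) (int p' + 1 - int q) es" for e es
        using q p by (subst reaches_Cons) (simp add: algebra_simps)
      note IH = less.hyps[of p' q, OF _ q]
      show ?thesis
      proof (cases n)
        case 0
        have "wsum 0 0 (\<lambda>i. real (p choose i)) (\<lambda>j. real (q choose j)) =
              wsum 0 0 (\<lambda>i. real (p' choose i)) (\<lambda>j. real (q choose j))"
          by (simp add: wsum_def)
        with 0 show ?thesis
          using IH[of 0] p step by (simp add: card_jump_lists_Suc_0)
      next
        case (Suc m)
        then show ?thesis
          using IH[of n] IH[of m] p step
          by (simp add: card_jump_lists_Suc_Suc wsum_binomial_Suc_left)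
      qed
    qed
  next
    show "real (card (jump_lists (p + q) n (reaches (- 1) (int p + 1 - int q)))) =
            wsum 1 n (\<lambda>i. real (p choose i)) (\<lambda>j. real (q choose j))"
    proof (cases q)
      case 0
      have "jump_lists p n (reaches (- 1) (int p + 1)) = {}"
        using not_reaches_down by (auto simp: jump_lists_def)
      \<comment> \<open>The second binomial leaves only i = n, whose weight is that of -n - 1, hence
        0.\<close>
      moreover have "wsum 1 n (\<lambda>i. real (p choose i)) (\<lambda>j. real (0 choose j)) = 0"
        unfolding wsum_def
        by (intro sum.neutral ballI) (auto simp: weight_def sgn_if binomial_eq_0_iff)
      ultimately show ?thesis using 0 by simp
    next
      case (Suc q')
      then have q: "q' \<le> p" using less.prems by simp
      have step: "reaches (- 1) (int p + 1 - int q) (e # es) \<longleftrightarrow>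
          reaches (if e then 1 else - 1) (int p + 1 - int q') es" for e es
        using less.prems Suc by (subst reaches_Cons) (simp add: algebra_simps)
      note IH = less.hyps[of p q', OF _ q]
      show ?thesis
      proof (cases n)
        case 0
        have "wsum 1 0 (\<lambda>i. real (p choose i)) (\<lambda>j. real (q choose j)) =
              wsum 1 0 (\<lambda>i. real (p choose i)) (\<lambda>j. real (q' choose j))"
          by (simp add: wsum_def)
        with 0 show ?thesis
          using IH[of 0] Suc step by (simp add: card_jump_lists_Suc_0)
      next
        case (Suc m)
        then show ?thesis
          using IH[of n] IH[of m] \<open>q = Suc q'\<close> step
          by (simp add: card_jump_lists_Suc_Suc wsum_binomial_Suc_right)
      qed
    qed
  qed
qed

section \<open>Scaling limits of the weighted sums and the recursion for them\<close>

lemma tendsto_binomial_scaled: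
  fixes p :: "nat \<Rightarrow> nat" and h :: "nat \<Rightarrow> real"
  assumes "(\<lambda>r. real (p r) * h r) \<longlonglongrightarrow> x" and "h \<longlonglongrightarrow> 0"
  shows "(\<lambda>r. real (p r choose i) * h r ^ i) \<longlonglongrightarrow> x ^ i / fact i"
proof -
  \<comment> \<open>Each of the i factors of the falling factorial absorbs one factor h, and the
    corrections l h vanish in the limit.\<close>
  have "(\<lambda>r. (\<Prod>l<i. real (p r) * h r - real l * h r) / fact i) \<longlonglongrightarrow> (\<Prod>l<i. x - real l * 0) / fact i"
    by (intro tendsto_intros assms) simp
  moreover have "(\<Prod>l<i. real (p r) * h r - real l * h r) / fact i = real (p r choose i) * h r ^ i" for r
  proof -
    have "(\<Prod>l<i. real (p r) * h r - real l * h r) = (\<Prod>l<i. real (p r) - real l) * h r ^ i"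
      by (simp add: prod.distrib flip: left_diff_distrib)
    then show ?thesis
      by (simp add: binomial_gbinomial gbinomial_prod_rev lessThan_atLeast0)
  qed
  ultimately show ?thesis by simp
qed

lemma tendsto_wsum_binomial:
  fixes p q :: "nat \<Rightarrow> nat" and h :: "nat \<Rightarrow> real"
  assumes "(\<lambda>r. real (p r) * h r) \<longlonglongrightarrow> x" and "(\<lambda>r. real (q r) * h r) \<longlonglongrightarrow> y" and "h \<longlonglongrightarrow> 0"
  shows "(\<lambda>r. wsum s n (\<lambda>i. real (p r choose i)) (\<lambda>j. real (q r choose j)) * h r ^ n)
           \<longlonglongrightarrow> wsum s n (\<lambda>i. x ^ i / fact i) (\<lambda>j. y ^ j / fact j)"
proof -
  have "(\<lambda>r. \<Sum>i\<le>n. weight (int n - 2 * int i - s) *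
            (real (p r choose i) * h r ^ i) * (real (q r choose (n - i)) * h r ^ (n - i)))
        \<longlonglongrightarrow> wsum s n (\<lambda>i. x ^ i / fact i) (\<lambda>j. y ^ j / fact j)"
    unfolding wsum_def by (intro tendsto_intros tendsto_binomial_scaled assms)
  moreover have "(\<Sum>i\<le>n. weight (int n - 2 * int i - s) *
            (real (p r choose i) * h r ^ i) * (real (q r choose (n - i)) * h r ^ (n - i))) =
         wsum s n (\<lambda>i. real (p r choose i)) (\<lambda>j. real (q r choose j)) * h r ^ n" for r
    unfolding wsum_def sum_distrib_right
    by (intro sum.cong refl) (simp add: mult_ac flip: power_add)
  ultimately show ?thesis by simp
qed

text \<open>Multiplication by x or y shifts a divided power,
  \<open>x * f i = (i + 1) * f (i + 1)\<close>, so all terms become sums over the monomials of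
  degree 2k + 1 and can be compared coefficient by coefficient.\<close>

lemma wsum_power_identity:
  fixes x y :: real
  defines "f \<equiv> \<lambda>i. x ^ i / fact i" and "g \<equiv> \<lambda>j. y ^ j / fact j"
  shows "(2 * real k + 2) * wsum 1 (2 * k + 1) f g = (x + y) * wsum 1 (2 * k) f g + wsum 0 (2 * k + 1) f g"
proof -
  have f: "x * f i = real (Suc i) * f (Suc i)" and g: "y * g i = real (Suc i) * g (Suc i)" for i
    by (simp_all add: f_def g_def field_simps del: of_nat_Suc)
  have "x * wsum 1 (2 * k) f g = (\<Sum>i\<le>2 * k. weight (2 * int k - 2 * int i - 1) * (x * f i) * g (2 * k - i))"
    by (simp add: wsum_def sum_distrib_left mult_ac)
  also have "\<dots> = (\<Sum>i\<le>2 * k. weight (2 * int k + 1 - 2 * int (Suc i)) * (real (Suc i) * f (Suc i)) * g (2 * k + 1 - Suc i))"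
    by (intro sum.cong refl) (simp add: f)
  \<comment> \<open>The new term i = 0 vanishes by its factor i; for y below, the new term i = 2k +
    1 vanishes by its factor 2k + 1 - i.\<close>
  also have "\<dots> = (\<Sum>i\<le>2 * k + 1. weight (2 * int k + 1 - 2 * int i) * (real i * f i) * g (2 * k + 1 - i))"
    unfolding Suc_eq_plus1[symmetric] by (subst sum.atMost_Suc_shift) simp
  finally have X: "x * wsum 1 (2 * k) f g = \<dots>" .
  have "y * wsum 1 (2 * k) f g = (\<Sum>i\<le>2 * k. weight (2 * int k - 2 * int i - 1) * f i * (y * g (2 * k - i)))"
    by (simp add: wsum_def sum_distrib_left mult_ac)
  also have "\<dots> = (\<Sum>i\<le>2 * k. weight (2 * int k - 2 * int i - 1) * f i * (real (2 * k + 1 - i) * g (2 * k + 1 - i)))"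
    by (intro sum.cong refl) (simp add: g Suc_diff_le)
  also have "\<dots> = (\<Sum>i\<le>2 * k + 1. weight (2 * int k - 2 * int i - 1) * f i * (real (2 * k + 1 - i) * g (2 * k + 1 - i)))"
    by simp
  finally have Y: "y * wsum 1 (2 * k) f g = \<dots>" .
  \<comment> \<open>All weights are 2 for i < k and 0 for i > k. At i = k the left one is 1 and the
    right ones are 2, 0, 2, and both sides are 2k + 2.\<close>
  have coeff: "(2 * real k + 2) * weight (2 * int k - 2 * int i) = weight (2 * int k + 1 - 2 * int i) * real i +
      weight (2 * int k - 2 * int i - 1) * real (2 * k + 1 - i) + weight (2 * int k + 1 - 2 * int i)" if "i \<le> 2 * k + 1" for i
    using that by (cases "i < k"; cases "i = k") (auto simp: weight_def sgn_if of_nat_diff algebra_simps)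
  have "(2 * real k + 2) * wsum 1 (2 * k + 1) f g =
      (\<Sum>i\<le>2 * k + 1. ((2 * real k + 2) * weight (2 * int k - 2 * int i)) * f i * g (2 * k + 1 - i))"
    unfolding wsum_def sum_distrib_left by (intro sum.cong refl) (simp add: mult_ac)
  also have "\<dots> = (\<Sum>i\<le>2 * k + 1. (weight (2 * int k + 1 - 2 * int i) * real i +
      weight (2 * int k - 2 * int i - 1) * real (2 * k + 1 - i) + weight (2 * int k + 1 - 2 * int i)) * f i * g (2 * k + 1 - i))"
    by (intro sum.cong refl) (simp only: coeff atMost_iff)
  also have "\<dots> = x * wsum 1 (2 * k) f g + y * wsum 1 (2 * k) f g + wsum 0 (2 * k + 1) f g"
    unfolding X Y unfolding wsum_def sum.distrib[symmetric]
    by (intro sum.cong refl) (simp add: algebra_simps)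
  finally show ?thesis by (simp add: distrib_right)
qed

section \<open>Discretisation of a single path\<close>

text \<open>A single path with a constant initial velocity \<open>a\<close>. On the event V = a the
  maximum thus becomes a functional of N alone, to which the independence of V and N can be
  applied.\<close>

definition signed_integral :: "real \<Rightarrow> (real \<Rightarrow> nat) \<Rightarrow> real \<Rightarrow> real" where
  "signed_integral a g s = (LBINT u:{0..s}. a * (- 1) ^ g u)"

definition path_max :: "real \<Rightarrow> (real \<Rightarrow> nat) \<Rightarrow> real \<Rightarrow> real" where
  "path_max a g t = (SUP s\<in>{0..t}. signed_integral a g s)"

lemma telegraph_max_eq_path_max: "telegraph_max V N t \<omega> = path_max (V \<omega>) (\<lambda>s. N s \<omega>) t"
  by (simp add: telegraph_max_def telegraph_def path_max_def signed_integral_def)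

lemma abs_sign_power [simp]: "\<bar>a * (- 1) ^ n\<bar> = \<bar>a :: real\<bar>"
  by (simp add: abs_mult)

lemma set_integrable_signed:
  fixes g :: "real \<Rightarrow> nat" and a :: real
  assumes "mono_on {0..} g" and A: "A \<subseteq> {0..}" "A \<in> sets lborel" "emeasure lborel A < \<infinity>"
  shows "set_integrable lborel A (\<lambda>u. a * (- 1) ^ g u)"
proof -
  \<comment> \<open>\<open>g\<close> is arbitrary at negative times; freezing it there at
    \<open>g 0\<close> makes it monotone on the whole line, hence Borel measurable.\<close>
  have "mono (\<lambda>u. real (g (max 0 u)))"
    using assms(1) by (auto simp: mono_def mono_on_def)
  then have "(\<lambda>u. real (g (max 0 u))) \<in> borel_measurable borel"
    by (rule borel_measurable_mono)
  then have "(\<lambda>u. nat \<lfloor>real (g (max 0 u))\<rfloor>) \<in> measurable borel (count_space UNIV)"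
    by measurable
  then have g: "(\<lambda>u. g (max 0 u)) \<in> measurable borel (count_space UNIV)"
    by simp
  have [measurable]: "(\<lambda>u. a * (- 1) ^ g (max 0 u)) \<in> borel_measurable borel"
    by (rule measurable_compose[OF g, of "\<lambda>n. a * (- 1) ^ n"]) simp
  have [measurable]: "A \<in> sets borel" using A(2) by simp
  have "set_integrable lborel A (\<lambda>u. a * (- 1) ^ g (max 0 u))"
    using A(3) unfolding set_integrable_def
    by (intro integrableI_bounded_set_indicator[where B = "\<bar>a\<bar>"]) auto
  then show ?thesis
    by (rule set_integrable_cong[THEN iffD1, rotated -1]) (use A(1) in auto)
qed

text \<open>The reference slope \<open>d\<close> is left free: \<open>d = 0\<close> gives the
  Lipschitz bound, and the velocity at the left end of a cell gives the discretisation error of that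
  cell.\<close>

lemma signed_integral_increment:
  fixes g :: "real \<Rightarrow> nat"
  assumes g: "mono_on {0..} g" and "0 \<le> u" "u \<le> v"
    and B: "\<And>s. u < s \<Longrightarrow> s \<le> v \<Longrightarrow> \<bar>a * (- 1) ^ g s - d\<bar> \<le> B"
  shows "\<bar>signed_integral a g v - signed_integral a g u - d * (v - u)\<bar> \<le> B * (v - u)"
proof -
  let ?f = "\<lambda>s. a * (- 1) ^ g s"
  have int: "set_integrable lborel {u<..v} ?f" "set_integrable lborel {0..u} ?f"
    using assms(2,3) by (auto intro!: set_integrable_signed[OF g])
  have const: "set_integrable lborel {u<..v} (\<lambda>_. e)" for e :: real
    unfolding set_integrable_def using assms(3)
    by (intro integrableI_bounded_set_indicator[where B = "\<bar>e\<bar>"]) auto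
  have "{0..v} = {0..u} \<union> {u<..v}" using assms by auto
  then have "signed_integral a g v - signed_integral a g u = (LBINT s:{u<..v}. ?f s)"
    using set_integral_Un[OF ivl_disj_int_two(8) int(2,1)] unfolding signed_integral_def by simp
  moreover have val: "(LBINT s:{u<..v}. e) = (v - u) * e" for e :: real
    using assms by (subst set_integral_const) auto
  moreover have "(LBINT s:{u<..v}. ?f s) \<le> (LBINT s:{u<..v}. d + B)"
    by (intro set_integral_mono int const) (use B in \<open>fastforce simp: abs_le_iff\<close>)
  moreover have "(LBINT s:{u<..v}. d - B) \<le> (LBINT s:{u<..v}. ?f s)"
    by (intro set_integral_mono int const) (use B in \<open>fastforce simp: abs_le_iff\<close>)
  ultimately show ?thesis
    by (simp add: val abs_le_iff algebra_simps)
qed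

lemma signed_integral_lipschitz:
  fixes g :: "real \<Rightarrow> nat"
  assumes "mono_on {0..} g" and "0 \<le> u" "u \<le> v"
  shows "\<bar>signed_integral a g v - signed_integral a g u\<bar> \<le> \<bar>a\<bar> * (v - u)"
  using signed_integral_increment[OF assms, of a 0 "\<bar>a\<bar>"] by simp

section \<open>Approximation of a path by a walk on the grid\<close>

definition grid_walk :: "real \<Rightarrow> (real \<Rightarrow> nat) \<Rightarrow> real \<Rightarrow> nat \<Rightarrow> real" where
  "grid_walk a g h i = h * (\<Sum>l<i. a * (- 1) ^ g (real l * h))"

lemma signed_integral_0 [simp]: "signed_integral a g 0 = 0"
  unfolding signed_integral_def set_lebesgue_integral_def
  by (rule integral_eq_zero_AE) (auto intro!: AE_I'[of "{0}"] split: split_indicator)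

text \<open>Only the cells that contain a jump contribute to the discretisation error.\<close>

lemma grid_walk_error:
  fixes g :: "real \<Rightarrow> nat"
  assumes g: "mono_on {0..} g" and h: "0 \<le> h"
  shows "\<bar>signed_integral a g (real i * h) - grid_walk a g h i\<bar> \<le> 2 * \<bar>a\<bar> * h * real (g (real i * h))"
proof (induction i)
  case 0
  then show ?case by (simp add: grid_walk_def h)
next
  case (Suc i)
  define u v where "u = real i * h" and "v = real (Suc i) * h"
  have uv: "0 \<le> u" "u \<le> v" "v - u = h" using h by (auto simp: u_def v_def algebra_simps)
  have le: "g u \<le> g v" using g uv by (auto simp: mono_on_def)
  \<comment> \<open>Measuring the error by the increment of \<open>g\<close> makes the sum over the
    cells telescope.\<close>
  have "\<bar>signed_integral a g v - signed_integral a g u - (a * (- 1) ^ g u) * (v - u)\<bar>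
      \<le> (2 * \<bar>a\<bar> * (real (g v) - real (g u))) * (v - u)"
  proof (rule signed_integral_increment[OF g uv(1,2)])
    fix s assume s: "u < s" "s \<le> v"
    then have gs: "g u \<le> g s" "g s \<le> g v" using g uv by (auto simp: mono_on_def)
    show "\<bar>a * (- 1) ^ g s - a * (- 1) ^ g u\<bar> \<le> 2 * \<bar>a\<bar> * (real (g v) - real (g u))"
    proof (cases "g u = g v")
      case True
      then show ?thesis using gs by simp
    next
      case False
      then have "1 \<le> real (g v) - real (g u)" using le by linarith
      then have "2 * \<bar>a\<bar> * 1 \<le> 2 * \<bar>a\<bar> * (real (g v) - real (g u))"
        by (intro mult_left_mono) auto
      moreover have "\<bar>a * (- 1) ^ g s - a * (- 1) ^ g u\<bar> \<le> 2 * \<bar>a\<bar>"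
        using abs_triangle_ineq4[of "a * (- 1) ^ g s" "a * (- 1) ^ g u"] by simp
      ultimately show ?thesis by simp
    qed
  qed
  moreover have "grid_walk a g h (Suc i) = grid_walk a g h i + (a * (- 1) ^ g u) * (v - u)"
    unfolding uv(3) by (simp add: grid_walk_def u_def algebra_simps)
  ultimately show ?case
    using Suc.IH unfolding uv(3) u_def[symmetric] v_def[symmetric] left_diff_distrib right_diff_distrib
    by (simp only: abs_le_iff mult.assoc mult.commute mult.left_commute) linarith
qed

lemma bdd_above_signed_integral:
  fixes g :: "real \<Rightarrow> nat"
  assumes "mono_on {0..} g"
  shows "bdd_above (signed_integral a g ` {0..t})"
proof (rule bdd_aboveI2)
  fix s assume "s \<in> {0..t}"
  then show "signed_integral a g s \<le> \<bar>a\<bar> * t"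
    using signed_integral_lipschitz[OF assms, of 0 s a] mult_left_mono[of s t "\<bar>a\<bar>"] by simp
qed

lemma path_max_nonneg:
  fixes g :: "real \<Rightarrow> nat"
  assumes "mono_on {0..} g" and "0 \<le> t"
  shows "0 \<le> path_max a g t"
  using cSUP_upper[OF _ bdd_above_signed_integral[OF assms(1)], of 0 t a] assms(2)
  by (simp add: path_max_def)

lemma path_max_le:
  fixes g :: "real \<Rightarrow> nat"
  assumes "mono_on {0..} g" and "0 \<le> t"
  shows "path_max a g t \<le> \<bar>a\<bar> * t"
  unfolding path_max_def
proof (rule cSUP_least)
  fix s assume "s \<in> {0..t}"
  then show "signed_integral a g s \<le> \<bar>a\<bar> * t"
    using signed_integral_lipschitz[OF assms(1), of 0 s a] mult_left_mono[of s t "\<bar>a\<bar>"] by simp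
qed (use assms(2) in simp)

text \<open>The walk has r + 1 steps and so leaves [0,t] by one cell; this costs the 1 next to
  \<open>2 * real (g t)\<close>.\<close>

lemma grid_walk_le_path_max:
  fixes g :: "real \<Rightarrow> nat"
  assumes g: "mono_on {0..} g" and h: "0 \<le> h" and t: "t = real r * h" and i: "i \<le> Suc r"
  shows "grid_walk a g h i \<le> path_max a g t + (2 * real (g t) + 1) * \<bar>a\<bar> * h"
proof -
  have *: "grid_walk a g h i \<le> path_max a g t + 2 * real (g t) * \<bar>a\<bar> * h" if "i \<le> r" for i
  proof -
    have le: "real i * h \<le> t" unfolding t using that h by (simp add: mult_right_mono)
    then have "g (real i * h) \<le> g t" using g h by (intro mono_onD[OF g]) (auto simp: t)
    then have "2 * \<bar>a\<bar> * h * real (g (real i * h)) \<le> 2 * \<bar>a\<bar> * h * real (g t)"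
      using h by (intro mult_left_mono) auto
    moreover have "signed_integral a g (real i * h) \<le> path_max a g t"
      unfolding path_max_def using le h by (intro cSUP_upper bdd_above_signed_integral[OF g]) auto
    ultimately show ?thesis
      using grid_walk_error[OF g h, of a i] by (simp add: mult_ac abs_le_iff)
  qed
  show ?thesis
  proof (cases "i \<le> r")
    case True
    moreover have "0 \<le> \<bar>a\<bar> * h" using h by simp
    ultimately show ?thesis using *[of i] by (simp add: algebra_simps)
  next
    case False
    then have i: "i = Suc r" using i by simp
    have "a * (- 1) ^ g (real r * h) \<le> \<bar>a\<bar>"
      using abs_sign_power[of a "g (real r * h)"] by linarith
    from mult_left_mono[OF this h]
    have "grid_walk a g h i \<le> grid_walk a g h r + \<bar>a\<bar> * h"
      by (simp add: i grid_walk_def algebra_simps)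
    then show ?thesis using *[of r] by (simp add: algebra_simps)
  qed
qed

text \<open>A time at which the path exceeds x is rounded down to the grid; the Lipschitz bound for
  less than one cell accounts for the 1 next to \<open>2 * real (g t)\<close>.\<close>

lemma path_max_le_grid_walk:
  fixes g :: "real \<Rightarrow> nat"
  assumes g: "mono_on {0..} g" and h: "0 < h" and t: "t = real r * h" and x: "x < path_max a g t"
  shows "\<exists>i\<le>r. x < grid_walk a g h i + (2 * real (g t) + 1) * \<bar>a\<bar> * h"
proof -
  have t0: "0 \<le> t" using h by (simp add: t)
  obtain s where s: "0 \<le> s" "s \<le> t" "x < signed_integral a g s"
    using x t0 unfolding path_max_def
    by (subst (asm) less_cSUP_iff) (auto intro: bdd_above_signed_integral[OF g])
  define i where "i = nat \<lfloor>s / h\<rfloor>"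
  have i: "real i * h \<le> s" "s \<le> real i * h + h" "i \<le> r"
  proof -
    have "real i = of_int \<lfloor>s / h\<rfloor>" using s h by (simp add: i_def)
    then have "real i \<le> s / h" "s / h \<le> real i + 1" by linarith+
    then show "real i * h \<le> s" "s \<le> real i * h + h" using h by (simp_all add: field_simps)
    then have "real i * h \<le> real r * h" using s t by linarith
    then show "i \<le> r" using h by simp
  qed
  have "g (real i * h) \<le> g t" using i s h by (intro mono_onD[OF g]) auto
  then have "2 * \<bar>a\<bar> * h * real (g (real i * h)) \<le> 2 * \<bar>a\<bar> * h * real (g t)"
    using h by (intro mult_left_mono) auto
  moreover have "\<bar>signed_integral a g s - signed_integral a g (real i * h)\<bar> \<le> \<bar>a\<bar> * h"
    using signed_integral_lipschitz[OF g, of "real i * h" s a] i h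
      mult_left_mono[of "s - real i * h" h "\<bar>a\<bar>"] by simp
  ultimately have "x < grid_walk a g h i + (2 * real (g t) + 1) * \<bar>a\<bar> * h"
    using grid_walk_error[OF g less_imp_le[OF h], of a i] s(3) by (simp add: algebra_simps abs_le_iff)
  with i(3) show ?thesis by blast
qed

text \<open>Serves measurability: the supremum over uncountably many times is a limit of finite
  maxima that depend on \<open>g\<close> at grid times only.\<close>

lemma grid_walk_max_tendsto:
  fixes g :: "real \<Rightarrow> nat"
  assumes g: "mono_on {0..} g" and t: "0 < t"
  shows "(\<lambda>r. Max ((\<lambda>i. grid_walk a g (t / real (Suc r)) i) ` {..Suc r})) \<longlonglongrightarrow> path_max a g t"
proof -
  let ?M = "\<lambda>r. Max ((\<lambda>i. grid_walk a g (t / real (Suc r)) i) ` {..Suc r})"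
  let ?e = "\<lambda>r. (2 * real (g t) + 1) * \<bar>a\<bar> * (t / real (Suc r))"
  have lower: "path_max a g t - ?e r \<le> ?M r" for r
  \<comment> \<open>The supremum is only approached from below, so the comparison is made for every
    y strictly below it.\<close>
  proof (rule dense_le)
    fix y assume "y < path_max a g t - ?e r"
    then have "y + ?e r < path_max a g t" by simp
    from path_max_le_grid_walk[OF g _ _ this, of "t / real (Suc r)" "Suc r"] t
    obtain i where "i \<le> Suc r" "y < grid_walk a g (t / real (Suc r)) i" by auto
    then show "y \<le> ?M r"
      by (intro less_imp_le less_le_trans[OF _ Max_ge]) auto
  qed
  have upper: "?M r \<le> path_max a g t + ?e r" for r
    using grid_walk_le_path_max[OF g, of "t / real (Suc r)" t "Suc r"] t by (subst Max_le_iff) auto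
  have e: "?e \<longlonglongrightarrow> 0"
    using tendsto_mult[OF tendsto_const[of "(2 * real (g t) + 1) * \<bar>a\<bar> * t"] LIMSEQ_inverse_real_of_nat]
    by (simp add: field_simps)
  show ?thesis
  proof (rule real_tendsto_sandwich)
    show "(\<lambda>r. path_max a g t - ?e r) \<longlonglongrightarrow> path_max a g t"
      using tendsto_diff[OF tendsto_const[of "path_max a g t"] e] by simp
    show "(\<lambda>r. path_max a g t + ?e r) \<longlonglongrightarrow> path_max a g t"
      using tendsto_add[OF tendsto_const[of "path_max a g t"] e] by simp
  qed (use lower upper in auto)
qed

text \<open>The space \<open>A\<close> is arbitrary because two sigma-algebras are meant: that of
  the probability space and the one generated by N.\<close>

lemma measurable_path_max:
  assumes N: "\<And>s. 0 \<le> s \<Longrightarrow> N s \<in> A \<rightarrow>\<^sub>M count_space UNIV" and t: "0 < t"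
    and mono: "\<And>\<omega>. \<omega> \<in> space A \<Longrightarrow> mono_on {0..} (\<lambda>s. N s \<omega> :: nat)"
  shows "(\<lambda>\<omega>. path_max a (\<lambda>s. N s \<omega>) t) \<in> borel_measurable A"
proof (rule borel_measurable_LIMSEQ_real)
  show "(\<lambda>r. Max ((\<lambda>i. grid_walk a (\<lambda>s. N s \<omega>) (t / real (Suc r)) i) ` {..Suc r}))
      \<longlonglongrightarrow> path_max a (\<lambda>s. N s \<omega>) t" if "\<omega> \<in> space A" for \<omega>
    by (rule grid_walk_max_tendsto[OF mono[OF that] t])
  show "(\<lambda>\<omega>. Max ((\<lambda>i. grid_walk a (\<lambda>s. N s \<omega>) (t / real (Suc r)) i) ` {..Suc r})) \<in> borel_measurable A" for r
  proof (rule borel_measurable_Max)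
    fix i
    have "(\<lambda>\<omega>. a * (- 1) ^ N (real l * (t / real (Suc r))) \<omega>) \<in> borel_measurable A" for l
      using t by (intro measurable_compose[OF N, of _ "\<lambda>n. a * (- 1) ^ n"]) auto
    then show "(\<lambda>\<omega>. grid_walk a (\<lambda>s. N s \<omega>) (t / real (Suc r)) i) \<in> borel_measurable A"
      unfolding grid_walk_def
      by (rule borel_measurable_times[OF borel_measurable_const borel_measurable_sum])
  qed simp
qed

section \<open>Law of the maximum given the number of jumps\<close>

text \<open>A cell with several jumps also yields \<open>False\<close>, so the word describes the
  path only under \<open>single_jumps\<close>.\<close>

definition jumps :: "nat \<Rightarrow> real \<Rightarrow> (real \<Rightarrow> nat) \<Rightarrow> bool list" where
  "jumps r h g = map (\<lambda>i. g (real (Suc i) * h) - g (real i * h) = 1) [0..<r]"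

definition single_jumps :: "nat \<Rightarrow> real \<Rightarrow> (real \<Rightarrow> nat) \<Rightarrow> bool" where
  "single_jumps r h g \<longleftrightarrow> (\<forall>i<r. g (real (Suc i) * h) - g (real i * h) \<le> 1)"

lemma length_jumps [simp]: "length (jumps r h g) = r"
  by (simp add: jumps_def)

lemma count_jumps:
  assumes "mono_on {0..} g" "g 0 = 0" "0 \<le> h" "single_jumps r h g" "l \<le> r"
  shows "count_list (take l (jumps r h g)) True = g (real l * h)"
  using assms(5)
proof (induction l)
  case (Suc l)
  have "g (real l * h) \<le> g (real (Suc l) * h)"
    using assms(3) by (intro mono_onD[OF assms(1)]) (auto simp: mult_right_mono)
  moreover have "g (real (Suc l) * h) - g (real l * h) \<le> 1"
    using assms(4) Suc.prems by (simp add: single_jumps_def)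
  moreover have "take (Suc l) (jumps r h g) = take l (jumps r h g) @ [g (real (Suc l) * h) - g (real l * h) = 1]"
    using Suc.prems by (simp add: take_Suc_conv_app_nth jumps_def)
  ultimately show ?case
    using Suc by simp linarith
qed (simp add: assms(2))

lemma reaches_jumps_iff:
  assumes "mono_on {0..} g" "g 0 = 0" "0 < h" "single_jumps r h g" "0 < c"
  shows "reaches \<sigma> b (jumps r h g) \<longleftrightarrow>
    (\<exists>i\<le>Suc r. c * h * real_of_int b \<le> grid_walk (of_int \<sigma> * c) g h i)"
proof -
  have "(\<Sum>l<i. \<sigma> * (- 1) ^ count_list (take l (jumps r h g)) True) =
      (\<Sum>l<i. \<sigma> * (- 1) ^ g (real l * h))" if "i \<le> Suc r" for i
    using that assms by (intro sum.cong refl) (simp add: count_jumps)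
  moreover have "grid_walk (of_int \<sigma> * c) g h i = c * h * of_int (\<Sum>l<i. \<sigma> * (- 1) ^ g (real l * h))" for i
    by (simp add: grid_walk_def sum_distrib_left mult_ac)
  ultimately show ?thesis
    unfolding reaches_def using assms(3,5) by (auto simp: mult_le_cancel_left_pos simp del: of_int_sum)
qed

section \<open>Probabilities of jump words under a Poisson process\<close>

locale poisson = prob_space M for M :: "'a measure" +
  fixes rate :: real and N :: "real \<Rightarrow> 'a \<Rightarrow> nat"
  assumes rate: "0 < rate" and N: "poisson_process M rate N"
begin

lemma measurable_N [measurable]: "0 \<le> s \<Longrightarrow> N s \<in> M \<rightarrow>\<^sub>M count_space UNIV"
  and N_0: "\<omega> \<in> space M \<Longrightarrow> N 0 \<omega> = 0"
  and mono_N: "\<omega> \<in> space M \<Longrightarrow> mono_on {0..} (\<lambda>s. N s \<omega>)"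
  using N by (auto simp: poisson_process_def)

lemma measurable_increment:
  assumes "0 \<le> s" "0 \<le> t"
  shows "(\<lambda>\<omega>. N t \<omega> - N s \<omega>) \<in> M \<rightarrow>\<^sub>M count_space UNIV"
  using measurable_N[OF assms(1)] measurable_N[OF assms(2)] by measurable

lemma prob_increment:
  assumes "0 \<le> s" "s < t"
  shows "prob {\<omega> \<in> space M. N t \<omega> - N s \<omega> = d} = (rate * (t - s)) ^ d / fact d * exp (- (rate * (t - s)))"
proof -
  have "prob {\<omega> \<in> space M. N t \<omega> - N s \<omega> = d} =
      measure (distr M (count_space UNIV) (\<lambda>\<omega>. N t \<omega> - N s \<omega>)) {d}"
    using assms by (subst measure_distr) (auto intro!: measurable_increment arg_cong[where f = prob])
  also have "\<dots> = measure_pmf.prob (poisson_pmf (rate * (t - s))) {d}"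
    using N assms by (simp add: poisson_process_def)
  also have "\<dots> = (rate * (t - s)) ^ d / fact d * exp (- (rate * (t - s)))"
    using rate assms by (simp add: measure_pmf_single)
  finally show ?thesis .
qed

lemma prob_count:
  assumes "0 < t"
  shows "prob {\<omega> \<in> space M. N t \<omega> = n} = (rate * t) ^ n / fact n * exp (- (rate * t))"
proof -
  have "{\<omega> \<in> space M. N t \<omega> = n} = {\<omega> \<in> space M. N t \<omega> - N 0 \<omega> = n}"
    by (auto simp: N_0)
  then show ?thesis
    using prob_increment[of 0 t n] assms by simp
qed

text \<open>Each cell contributes exp(-rate h), times rate h if it holds a jump. The product sees a
  word only through its number of \<open>True\<close> letters, whence the equal likelihood.\<close>

lemma prob_increments:
  assumes h: "0 < h" and r: "0 < r" and es: "length es = r"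
  shows "{\<omega> \<in> space M. \<forall>i<r. N (real (Suc i) * h) \<omega> - N (real i * h) \<omega> = of_bool (es ! i)} \<in> events"
    and "prob {\<omega> \<in> space M. \<forall>i<r. N (real (Suc i) * h) \<omega> - N (real i * h) \<omega> = of_bool (es ! i)} =
      exp (- (rate * (real r * h))) * (rate * h) ^ count_list es True"
proof -
  let ?D = "\<lambda>i \<omega>. N (real (Suc i) * h) \<omega> - N (real i * h) \<omega>"
  have D: "?D i \<in> M \<rightarrow>\<^sub>M count_space UNIV" for i
    using h by (intro measurable_increment) auto
  have eq: "{\<omega> \<in> space M. \<forall>i<r. ?D i \<omega> = of_bool (es ! i)} =
      (\<Inter>i\<in>{..<r}. ?D i -` {of_bool (es ! i)} \<inter> space M)"
    using r by auto
  show "{\<omega> \<in> space M. \<forall>i<r. ?D i \<omega> = of_bool (es ! i)} \<in> events"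
    unfolding eq using r by (intro sets.finite_INT measurable_sets[OF D]) auto
  have indep: "indep_vars (\<lambda>_. count_space UNIV) ?D {..<r}"
    using N h unfolding poisson_process_def
    by (elim conjE allE[where x = r]) (erule allE[where x = "\<lambda>i. real i * h"], simp)
  have "prob {\<omega> \<in> space M. \<forall>i<r. ?D i \<omega> = of_bool (es ! i)} =
      (\<Prod>i<r. prob (?D i -` {of_bool (es ! i)} \<inter> space M))"
    unfolding eq using r by (intro indep_varsD[OF indep]) auto
  also have "\<dots> = (\<Prod>i<r. exp (- (rate * h)) * (rate * h) ^ of_bool (es ! i))"
  proof (rule prod.cong[OF refl])
    fix i
    have "?D i -` {of_bool (es ! i)} \<inter> space M = {\<omega> \<in> space M. ?D i \<omega> = of_bool (es ! i)}"
      by auto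
    then show "prob (?D i -` {of_bool (es ! i)} \<inter> space M) = exp (- (rate * h)) * (rate * h) ^ of_bool (es ! i)"
      using prob_increment[of "real i * h" "real (Suc i) * h" "of_bool (es ! i)"] h
      by (simp add: algebra_simps)
  qed
  also have "\<dots> = exp (- (rate * (real r * h))) * (rate * h) ^ (\<Sum>i<r. of_bool (es ! i))"
    by (simp add: prod.distrib power_sum exp_of_nat_mult[symmetric] mult_ac del: sum_of_bool_eq)
  also have "(\<Sum>i<r. of_bool (es ! i)) = count_list es True"
    unfolding es[symmetric]
    by (induction es) (simp_all add: sum.lessThan_Suc_shift del: sum.lessThan_Suc sum_of_bool_eq)
  finally show "prob {\<omega> \<in> space M. \<forall>i<r. ?D i \<omega> = of_bool (es ! i)} =
      exp (- (rate * (real r * h))) * (rate * h) ^ count_list es True" .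
qed

text \<open>The event splits into disjoint events, one for each word. Without multiple jumps the
  word determines N(t), so the condition N(t) = n is already contained in
  \<open>jump_lists\<close>.\<close>

lemma prob_jumps:
  fixes P :: "bool list \<Rightarrow> bool" and n :: nat
  assumes t: "0 < t" and r: "0 < r" and h: "h = t / real r"
  defines "E \<equiv> {\<omega> \<in> space M. N t \<omega> = n \<and> single_jumps r h (\<lambda>s. N s \<omega>) \<and> P (jumps r h (\<lambda>s. N s \<omega>))}"
  shows "E \<in> events" and "prob E = exp (- (rate * t)) * (rate * h) ^ n * real (card (jump_lists r n P))"
proof -
  let ?A = "\<lambda>es. {\<omega> \<in> space M. \<forall>i<r. N (real (Suc i) * h) \<omega> - N (real i * h) \<omega> = of_bool (es ! i)}"
  have h0: "0 < h" and rh: "real r * h = t" using t r h by auto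
  let ?B = "\<lambda>es. {\<omega> \<in> space M. single_jumps r h (\<lambda>s. N s \<omega>) \<and> jumps r h (\<lambda>s. N s \<omega>) = es}"
  have A: "?A es = {\<omega> \<in> space M. single_jumps r h (\<lambda>s. N s \<omega>) \<and> jumps r h (\<lambda>s. N s \<omega>) = es}"
    if "length es = r" for es
  proof -
    have "(\<forall>i<r. N (real (Suc i) * h) \<omega> - N (real i * h) \<omega> = of_bool (es ! i)) \<longleftrightarrow>
        single_jumps r h (\<lambda>s. N s \<omega>) \<and> jumps r h (\<lambda>s. N s \<omega>) = es" for \<omega>
    proof -
      have "(d = of_bool b) \<longleftrightarrow> d \<le> 1 \<and> (d = 1) = b" for d :: nat and b
        by (cases b) auto
      then show ?thesis
        unfolding single_jumps_def list_eq_iff_nth_eq using that by (auto simp: jumps_def)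
    qed
    then show ?thesis by auto
  qed
  have E: "E = (\<Union>es\<in>jump_lists r n P. ?B es)"
  proof -
    have "count_list (jumps r h (\<lambda>s. N s \<omega>)) True = N t \<omega>"
      if "\<omega> \<in> space M" "single_jumps r h (\<lambda>s. N s \<omega>)" for \<omega>
      using count_jumps[OF mono_N N_0, OF that(1) that(1) _ that(2), of r] h0 rh by simp
    then show ?thesis
      unfolding E_def by (force simp: jump_lists_def)
  qed
  have ev: "?B ` jump_lists r n P \<subseteq> events"
  proof (rule image_subsetI)
    fix es assume "es \<in> jump_lists r n P"
    then have len: "length es = r" by (simp add: jump_lists_def)
    show "?B es \<in> events"
      using prob_increments(1)[OF h0 r len] unfolding A[OF len] .
  qed
  show "E \<in> events"
    unfolding E using ev by (intro sets.finite_UN finite_jump_lists) auto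
  have "prob E = (\<Sum>es\<in>jump_lists r n P. prob (?B es))"
    unfolding E using ev
    by (intro finite_measure_finite_Union finite_jump_lists)
       (auto simp: disjoint_family_on_def)
  also have "\<dots> = (\<Sum>es\<in>jump_lists r n P. exp (- (rate * t)) * (rate * h) ^ n)"
  proof (rule sum.cong[OF refl])
    fix es assume "es \<in> jump_lists r n P"
    then have len: "length es = r" and count: "count_list es True = n" by (simp_all add: jump_lists_def)
    show "prob (?B es) = exp (- (rate * t)) * (rate * h) ^ n"
      using prob_increments(2)[OF h0 r len] unfolding A[OF len] rh count .
  qed
  finally show "prob E = exp (- (rate * t)) * (rate * h) ^ n * real (card (jump_lists r n P))"
    by simp
qed

text \<open>Only q h \<rightarrow> y matters, so \<open>q\<close> may deviate from y / h by any
  bounded amount; a lower and an upper approximation then share their limit. The bound y < t/2 makes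
  \<open>2 * q r \<le> r\<close> hold eventually, as the counting formula requires.\<close>

lemma tendsto_prob_reaches:
  fixes h :: "nat \<Rightarrow> real" and q :: "nat \<Rightarrow> nat"
  assumes t: "0 < t" and y: "y < t / 2" and h: "h = (\<lambda>r. t / real r)"
    and q: "\<And>r. 0 < r \<Longrightarrow> \<bar>real (q r) - y / h r\<bar> \<le> C"
    and \<sigma>: "\<sigma> = 1 \<and> s = 0 \<or> \<sigma> = - 1 \<and> s = 1"
  shows "(\<lambda>r. exp (- (rate * t)) * (rate * h r) ^ n *
            real (card (jump_lists r n (reaches \<sigma> (int r + 1 - 2 * int (q r))))))
     \<longlonglongrightarrow> exp (- (rate * t)) * rate ^ n * wsum s n (\<lambda>i. (t - y) ^ i / fact i) (\<lambda>j. y ^ j / fact j)"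
proof -
  have h0: "h \<longlonglongrightarrow> 0"
    unfolding h by (rule lim_const_over_n)
  have pos: "\<forall>\<^sub>F r in sequentially. 0 < r"
    by (rule eventually_gt_at_top)
  have qlim: "(\<lambda>r. real (q r) * h r) \<longlonglongrightarrow> y"
  proof (rule LIM_zero_cancel, rule Lim_null_comparison)
    show "\<forall>\<^sub>F r in sequentially. norm (real (q r) * h r - y) \<le> C * h r"
      using pos
    proof eventually_elim
      case (elim r)
      then have "0 < h r" using t by (simp add: h)
      then have "real (q r) * h r - y = (real (q r) - y / h r) * h r"
        by (simp add: field_simps)
      then show ?case
        using q[OF elim] \<open>0 < h r\<close> by (simp add: abs_mult mult_right_mono)
    qed
    show "(\<lambda>r. C * h r) \<longlonglongrightarrow> 0"
      using tendsto_mult[OF tendsto_const[of C] h0] by simp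
  qed
  have small: "\<forall>\<^sub>F r in sequentially. 0 < r \<and> 2 * q r \<le> r"
    using order_tendstoD(2)[OF qlim y] pos
  proof eventually_elim
    case (elim r)
    then have "2 * real (q r) < real r"
      using t by (simp add: h field_simps)
    then show ?case using elim by linarith
  qed
  have plim: "(\<lambda>r. real (r - q r) * h r) \<longlonglongrightarrow> t - y"
  proof (rule Lim_transform_eventually)
    show "(\<lambda>r. t - real (q r) * h r) \<longlonglongrightarrow> t - y"
      by (intro tendsto_intros qlim)
    show "\<forall>\<^sub>F r in sequentially. t - real (q r) * h r = real (r - q r) * h r"
      using small by eventually_elim (simp add: h of_nat_diff field_simps)
  qed
  have "(\<lambda>r. exp (- (rate * t)) * rate ^ n *
      (wsum s n (\<lambda>i. real ((r - q r) choose i)) (\<lambda>j. real (q r choose j)) * h r ^ n))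
     \<longlonglongrightarrow> exp (- (rate * t)) * rate ^ n * wsum s n (\<lambda>i. (t - y) ^ i / fact i) (\<lambda>j. y ^ j / fact j)"
    by (intro tendsto_intros tendsto_wsum_binomial plim qlim h0)
  then show ?thesis
  proof (rule Lim_transform_eventually)
    show "\<forall>\<^sub>F r in sequentially. exp (- (rate * t)) * rate ^ n *
        (wsum s n (\<lambda>i. real ((r - q r) choose i)) (\<lambda>j. real (q r choose j)) * h r ^ n) =
      exp (- (rate * t)) * (rate * h r) ^ n *
        real (card (jump_lists r n (reaches \<sigma> (int r + 1 - 2 * int (q r)))))"
      using small
    proof eventually_elim
      case (elim r)
      then have "q r \<le> r - q r" "r - q r + q r = r" "int (r - q r) + 1 - int (q r) = int r + 1 - 2 * int (q r)"
        by auto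
      then have "real (card (jump_lists r n (reaches \<sigma> (int r + 1 - 2 * int (q r))))) =
          wsum s n (\<lambda>i. real ((r - q r) choose i)) (\<lambda>j. real (q r choose j))"
        using card_jump_lists_reaches[of "q r" "r - q r" n] \<sigma> by auto
      then show ?case by (simp add: power_mult_distrib)
    qed
  qed
qed

text \<open>The subtracted term is the probability of N(t) = n without multiple jumps, since r
  choose n words have n jumps. The difference is thus the probability that n jumps occur and some
  cell holds several.\<close>

lemma tendsto_prob_multiple_jumps:
  assumes t: "0 < t"
  shows "(\<lambda>r. prob {\<omega> \<in> space M. N t \<omega> = n} -
            exp (- (rate * t)) * (rate * (t / real r)) ^ n * real (r choose n)) \<longlonglongrightarrow> 0"
proof -
  have "(\<lambda>r. t) \<longlonglongrightarrow> t" by (rule tendsto_const)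
  then have "(\<lambda>r. real r * (t / real r)) \<longlonglongrightarrow> t"
    by (rule Lim_transform_eventually)
       (use eventually_gt_at_top[of 0] in \<open>eventually_elim, simp\<close>)
  from tendsto_binomial_scaled[OF this lim_const_over_n]
  have "(\<lambda>r. prob {\<omega> \<in> space M. N t \<omega> = n} -
      exp (- (rate * t)) * rate ^ n * (real (r choose n) * (t / real r) ^ n))
      \<longlonglongrightarrow> prob {\<omega> \<in> space M. N t \<omega> = n} - exp (- (rate * t)) * rate ^ n * (t ^ n / fact n)"
    by (intro tendsto_intros)
  also have "prob {\<omega> \<in> space M. N t \<omega> = n} - exp (- (rate * t)) * rate ^ n * (t ^ n / fact n) = 0"
    using prob_count[OF t] by (simp add: power_mult_distrib)
  finally show ?thesis
    by (simp add: power_mult_distrib power_divide mult_ac)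
qed

lemma measurable_path_max_N: "0 < t \<Longrightarrow> (\<lambda>\<omega>. path_max a (\<lambda>s. N s \<omega>) t) \<in> borel_measurable M"
  by (intro measurable_path_max measurable_N mono_N)

text \<open>Here y is the time that a path with position \<beta> at time t has spent moving down.
  The probability is squeezed between the probabilities of reaching a slightly higher and a slightly
  lower grid level.\<close>

lemma prob_path_max_greater:
  assumes c: "0 < c" and \<beta>: "0 < \<beta>" "\<beta> < c * t"
    and \<sigma>: "\<sigma> = 1 \<and> s = 0 \<or> \<sigma> = - 1 \<and> s = (1 :: int)"
  defines "y \<equiv> (t - \<beta> / c) / 2"
  shows "prob {\<omega> \<in> space M. N t \<omega> = n \<and> \<beta> < path_max (of_int \<sigma> * c) (\<lambda>s. N s \<omega>) t} =
    exp (- (rate * t)) * rate ^ n * wsum s n (\<lambda>i. (t - y) ^ i / fact i) (\<lambda>j. y ^ j / fact j)"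
proof -
  have t: "0 < t" using c \<beta> by (metis less_trans zero_less_mult_pos)
  define h where "h = (\<lambda>r. t / real r)"
  have y: "0 < y" "y < t / 2" using c \<beta> by (auto simp: y_def field_simps)
  define k where "k r = nat \<lfloor>y / h r\<rfloor>" for r
  define b where "b q r = int r + 1 - 2 * int (q r)" for q :: "nat \<Rightarrow> nat" and r
  \<comment> \<open>One unit of q moves the level by 2ch, and the grid error is (2n + 1)ch. Shifts
    by n + 2 and n + 3 cover this error and the rounding in \<open>k\<close>: \<open>q1\<close>
    raises the level for the lower bound, \<open>q2\<close> lowers it for the upper bound.\<close>
  define q1 where "q1 r = k r - (n + 2)" for r
  define q2 where "q2 r = k r + (n + 3)" for r
  define mx where "mx \<omega> = path_max (of_int \<sigma> * c) (\<lambda>s. N s \<omega>) t" for \<omega>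
  define E where "E r P = {\<omega> \<in> space M. N t \<omega> = n \<and> single_jumps r (h r) (\<lambda>s. N s \<omega>) \<and> P (jumps r (h r) (\<lambda>s. N s \<omega>))}"
    for r P
  let ?G = "prob {\<omega> \<in> space M. N t \<omega> = n \<and> \<beta> < mx \<omega>}"
  have abs_a: "\<bar>of_int \<sigma> * c\<bar> = c" using \<sigma> c by auto
  have k: "real (k r) \<le> y / h r" "y / h r < real (k r) + 1" for r
  proof -
    have "0 \<le> y / h r" using y t by (simp add: h_def)
    then have "real (k r) = of_int \<lfloor>y / h r\<rfloor>" by (simp add: k_def)
    then show "real (k r) \<le> y / h r" "y / h r < real (k r) + 1" by linarith+
  qed
  have E: "E r P \<in> events"
      "prob (E r P) = exp (- (rate * t)) * (rate * h r) ^ n * real (card (jump_lists r n P))" if "0 < r" for r P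
    unfolding E_def using prob_jumps[OF t that, of "h r" n P] by (auto simp: h_def)
  have lim: "(\<lambda>r. exp (- (rate * t)) * (rate * h r) ^ n * real (card (jump_lists r n (reaches \<sigma> (b q r)))))
      \<longlonglongrightarrow> exp (- (rate * t)) * rate ^ n * wsum s n (\<lambda>i. (t - y) ^ i / fact i) (\<lambda>j. y ^ j / fact j)"
    if "\<And>r. \<bar>real (q r) - y / h r\<bar> \<le> real n + 4" for q
    unfolding b_def by (rule tendsto_prob_reaches[OF t y(2) h_def that \<sigma>])
  have q1: "\<bar>real (q1 r) - y / h r\<bar> \<le> real n + 4" for r
  proof (cases "n + 2 \<le> k r")
    case True
    then have "real (q1 r) = real (k r) - real n - 2" by (simp add: q1_def of_nat_diff)
    then show ?thesis using k[of r] by linarith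
  next
    case False
    then have "q1 r = 0" "real (k r) < real n + 2" by (simp_all add: q1_def)
    then show ?thesis using k[of r] by linarith
  qed
  have q2: "\<bar>real (q2 r) - y / h r\<bar> \<le> real n + 4" for r
    using k[of r] unfolding q2_def of_nat_add by simp
  \<comment> \<open>The real number y / h is the value of q whose level corresponds to \<beta>, up
    to the one extra step.\<close>
  have level: "c * h r * (real r - 2 * (y / h r)) = \<beta>" if "0 < r" for r
    using that t c by (simp add: h_def y_def field_simps)
  have mx[measurable]: "mx \<in> borel_measurable M"
    unfolding mx_def by (rule measurable_path_max_N[OF t])
  have [measurable]: "N t \<in> M \<rightarrow>\<^sub>M count_space UNIV" using t by simp
  have lower: "\<forall>\<^sub>F r in sequentially.
      exp (- (rate * t)) * (rate * h r) ^ n * real (card (jump_lists r n (reaches \<sigma> (b q1 r)))) \<le> ?G"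
  proof -
    \<comment> \<open>From \<open>r0\<close> on, \<open>k r\<close> is at least n + 2, so the
      subtraction in \<open>q1\<close> is not truncated.\<close>
    obtain r0 where r0: "real r0 > (real n + 3) * t / y" using reals_Archimedean2 by blast
    have "exp (- (rate * t)) * (rate * h r) ^ n * real (card (jump_lists r n (reaches \<sigma> (b q1 r)))) \<le> ?G"
      if r: "0 < r" "r0 \<le> r" for r
    proof -
      have h: "0 < h r" "t = real r * h r" using r t by (auto simp: h_def)
      have "(real n + 3) * t / y < real r" using r r0 by linarith
      then have "real n + 3 < y / h r" using y t r by (simp add: h_def field_simps)
      then have "n + 2 \<le> k r" using k[of r] by linarith
      then have "real (q1 r) = real (k r) - real n - 2" by (simp add: q1_def of_nat_diff)
      then have "real (q1 r) \<le> y / h r - real n - 2" using k[of r] by linarith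
      then have "real r - 2 * (y / h r) < real_of_int (b q1 r) - (2 * real n + 1)"
        by (simp add: b_def)
      then have "c * h r * (real r - 2 * (y / h r)) < c * h r * (real_of_int (b q1 r) - (2 * real n + 1))"
        using c h by (intro mult_strict_left_mono) auto
      then have \<beta>_less: "\<beta> < c * h r * real_of_int (b q1 r) - (2 * real n + 1) * c * h r"
        unfolding level[OF r(1)] by (simp add: algebra_simps)
      have "E r (reaches \<sigma> (b q1 r)) \<subseteq> {\<omega> \<in> space M. N t \<omega> = n \<and> \<beta> < mx \<omega>}"
      proof
        fix \<omega> assume \<omega>: "\<omega> \<in> E r (reaches \<sigma> (b q1 r))"
        then have \<omega>': "\<omega> \<in> space M" "single_jumps r (h r) (\<lambda>s. N s \<omega>)" "N t \<omega> = n"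
          by (auto simp: E_def)
        obtain i where i: "i \<le> Suc r" "c * h r * real_of_int (b q1 r) \<le> grid_walk (of_int \<sigma> * c) (\<lambda>s. N s \<omega>) (h r) i"
          using \<omega> reaches_jumps_iff[OF mono_N N_0 h(1) \<omega>'(2) c, OF \<omega>'(1,1)] by (auto simp: E_def)
        have "grid_walk (of_int \<sigma> * c) (\<lambda>s. N s \<omega>) (h r) i \<le> mx \<omega> + (2 * real n + 1) * c * h r"
          using grid_walk_le_path_max[OF mono_N[OF \<omega>'(1)] less_imp_le[OF h(1)] h(2) i(1), of "of_int \<sigma> * c"]
          by (simp only: abs_a \<omega>'(3) mx_def)
        then show "\<omega> \<in> {\<omega> \<in> space M. N t \<omega> = n \<and> \<beta> < mx \<omega>}"
          using i \<beta>_less \<omega>' by auto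
      qed
      then have "prob (E r (reaches \<sigma> (b q1 r))) \<le> ?G"
        by (intro finite_measure_mono) measurable
      then show ?thesis by (simp only: E(2)[OF r(1)])
    qed
    then show ?thesis
      unfolding eventually_sequentially by (intro exI[of _ "max 1 r0"]) auto
  qed
  have upper: "\<forall>\<^sub>F r in sequentially. ?G \<le>
      exp (- (rate * t)) * (rate * h r) ^ n * real (card (jump_lists r n (reaches \<sigma> (b q2 r)))) +
      (prob {\<omega> \<in> space M. N t \<omega> = n} - exp (- (rate * t)) * (rate * (t / real r)) ^ n * real (r choose n))"
    using eventually_gt_at_top[of 0]
  proof eventually_elim
    case (elim r)
    then have h: "0 < h r" "t = real r * h r" using t by (auto simp: h_def)
    have "y / h r - 1 + real n + 3 \<le> real (q2 r)"
      using k[of r] unfolding q2_def of_nat_add by simp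
    then have "real_of_int (b q2 r) + (2 * real n + 1) \<le> real r - 2 * (y / h r)"
      by (simp add: b_def)
    then have "c * h r * (real_of_int (b q2 r) + (2 * real n + 1)) \<le> c * h r * (real r - 2 * (y / h r))"
      using c h by (intro mult_left_mono) auto
    then have le_\<beta>: "c * h r * real_of_int (b q2 r) + (2 * real n + 1) * c * h r \<le> \<beta>"
      unfolding level[OF elim] by (simp add: algebra_simps)
    have "{\<omega> \<in> space M. N t \<omega> = n \<and> \<beta> < mx \<omega>} \<subseteq>
        E r (reaches \<sigma> (b q2 r)) \<union> ({\<omega> \<in> space M. N t \<omega> = n} - E r (\<lambda>_. True))"
    proof
      fix \<omega> assume "\<omega> \<in> {\<omega> \<in> space M. N t \<omega> = n \<and> \<beta> < mx \<omega>}"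
      then have \<omega>: "\<omega> \<in> space M" "N t \<omega> = n" "\<beta> < mx \<omega>" by auto
      show "\<omega> \<in> E r (reaches \<sigma> (b q2 r)) \<union> ({\<omega> \<in> space M. N t \<omega> = n} - E r (\<lambda>_. True))"
      proof (cases "single_jumps r (h r) (\<lambda>s. N s \<omega>)")
        case True
        obtain i where "i \<le> r" "\<beta> < grid_walk (of_int \<sigma> * c) (\<lambda>s. N s \<omega>) (h r) i + (2 * real n + 1) * c * h r"
          using path_max_le_grid_walk[OF mono_N[OF \<omega>(1)] h, of \<beta> "of_int \<sigma> * c"] \<omega>(3)
          unfolding abs_a \<omega>(2) mx_def by auto
        then have "i \<le> Suc r" "c * h r * real_of_int (b q2 r) \<le> grid_walk (of_int \<sigma> * c) (\<lambda>s. N s \<omega>) (h r) i"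
          using le_\<beta> by linarith+
        then have "reaches \<sigma> (b q2 r) (jumps r (h r) (\<lambda>s. N s \<omega>))"
          using reaches_jumps_iff[OF mono_N N_0 h(1) True c, OF \<omega>(1,1)] by blast
        then show ?thesis using \<omega> True by (simp add: E_def)
      next
        case False
        then show ?thesis using \<omega> by (simp add: E_def)
      qed
    qed
    then have "?G \<le> prob (E r (reaches \<sigma> (b q2 r)) \<union> ({\<omega> \<in> space M. N t \<omega> = n} - E r (\<lambda>_. True)))"
      by (intro finite_measure_mono sets.Un sets.Diff E(1)[OF elim]) measurable
    also have "\<dots> \<le> prob (E r (reaches \<sigma> (b q2 r))) + prob ({\<omega> \<in> space M. N t \<omega> = n} - E r (\<lambda>_. True))"
      by (intro measure_Un_le sets.Diff E(1)[OF elim]) measurable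
    also have "prob ({\<omega> \<in> space M. N t \<omega> = n} - E r (\<lambda>_. True)) =
        prob {\<omega> \<in> space M. N t \<omega> = n} - prob (E r (\<lambda>_. True))"
    proof (rule finite_measure_Diff[OF _ E(1)[OF elim]])
      show "{\<omega> \<in> space M. N t \<omega> = n} \<in> events" by measurable
    qed (auto simp: E_def)
    finally show ?case
      unfolding E(2)[OF elim] card_jump_lists_True h_def .
  qed
  have "?G = exp (- (rate * t)) * rate ^ n * wsum s n (\<lambda>i. (t - y) ^ i / fact i) (\<lambda>j. y ^ j / fact j)"
  proof (rule antisym)
    show "?G \<le> exp (- (rate * t)) * rate ^ n * wsum s n (\<lambda>i. (t - y) ^ i / fact i) (\<lambda>j. y ^ j / fact j)"
      using tendsto_add[OF lim[OF q2] tendsto_prob_multiple_jumps[OF t, of n]] upper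
      by (intro tendsto_lowerbound) auto
    show "exp (- (rate * t)) * rate ^ n * wsum s n (\<lambda>i. (t - y) ^ i / fact i) (\<lambda>j. y ^ j / fact j) \<le> ?G"
      using lim[OF q1] lower by (intro tendsto_upperbound) auto
  qed
  then show ?thesis by (simp add: mx_def)
qed

end

text \<open>Open upper half-lines are stable under intersection and generate the Borel sets. As p
  and q may have any sign, the right-hand side is treated as a set function; it respects complements
  because p + q = 1.\<close>

lemma measure_combination_eqI:
  fixes M1 M2 M3 :: "real measure" and p q :: real
  assumes fin: "prob_space M1" "prob_space M2" "prob_space M3"
    and sets: "sets M1 = sets borel" "sets M2 = sets borel" "sets M3 = sets borel"
    and pq: "p + q = 1"
    and tails: "\<And>x. measure M1 {x<..} = p * measure M2 {x<..} + q * measure M3 {x<..}"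
    and B: "B \<in> sets borel"
  shows "measure M1 B = p * measure M2 B + q * measure M3 B"
proof -
  interpret M1: prob_space M1 by fact
  interpret M2: prob_space M2 by fact
  interpret M3: prob_space M3 by fact
  have space: "space M1 = UNIV" "space M2 = UNIV" "space M3 = UNIV"
    using sets[THEN sets_eq_imp_space_eq] by auto
  have borel: "sigma_sets UNIV (range greaterThan) = sets (borel :: real measure)"
    unfolding borel_Ioi by (rule sets_measure_of[symmetric]) simp
  have "Int_stable (range (greaterThan :: real \<Rightarrow> _))"
  proof (rule Int_stableI_image)
    fix a b :: real
    show "\<exists>d\<in>UNIV. {a<..} \<inter> {b<..} = {d<..}"
      by (intro bexI[of _ "max a b"]) auto
  qed
  moreover have "range greaterThan \<subseteq> Pow (UNIV :: real set)"
    by simp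
  moreover have "B \<in> sigma_sets UNIV (range greaterThan)"
    using B borel by simp
  ultimately show ?thesis
  proof (induction B rule: sigma_sets_induct_disjoint)
    case (basic A)
    then show ?case using tails by auto
  next
    case empty
    show ?case by simp
  next
    case (compl A)
    then have "A \<in> sets M1" "A \<in> sets M2" "A \<in> sets M3" using borel sets by auto
    then have "measure M1 (UNIV - A) = 1 - measure M1 A" "measure M2 (UNIV - A) = 1 - measure M2 A"
        "measure M3 (UNIV - A) = 1 - measure M3 A"
      using M1.prob_compl M2.prob_compl M3.prob_compl space by auto
    with \<open>measure M1 A = p * measure M2 A + q * measure M3 A\<close> show ?case
      using pq by algebra
  next
    case (union A)
    then have ran: "range A \<subseteq> sets M1" "range A \<subseteq> sets M2" "range A \<subseteq> sets M3"
      using borel sets by auto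
    have "(\<lambda>i. p * measure M2 (A i) + q * measure M3 (A i)) sums
        (p * measure M2 (\<Union>i. A i) + q * measure M3 (\<Union>i. A i))"
      by (intro sums_add sums_mult M2.finite_measure_UNION M3.finite_measure_UNION ran union)
    moreover have "(\<lambda>i. measure M1 (A i)) sums measure M1 (\<Union>i. A i)"
      by (intro M1.finite_measure_UNION ran union)
    ultimately show ?case
      using union(3) sums_unique2 by fastforce
  qed
qed

section \<open>Conditional laws of the maximum and their recursion\<close>

context poisson
begin

text \<open>The condition on V is replaced by the constant velocity \<open>a\<close>, so only N(t) =
  n is conditioned on.\<close>

definition max_law :: "real \<Rightarrow> real \<Rightarrow> nat \<Rightarrow> real measure" where
  "max_law a t n = distr (uniform_measure M {\<omega> \<in> space M. N t \<omega> = n}) borel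
     (\<lambda>\<omega>. path_max a (\<lambda>s. N s \<omega>) t)"

lemma sets_max_law [simp]: "sets (max_law a t n) = sets borel"
  by (simp add: max_law_def)

lemma prob_count_pos: "0 < t \<Longrightarrow> 0 < prob {\<omega> \<in> space M. N t \<omega> = n}"
  using rate by (simp add: prob_count)

lemma prob_space_max_law:
  assumes t: "0 < t"
  shows "prob_space (max_law a t n)"
  unfolding max_law_def
proof (rule prob_space.prob_space_distr)
  show "prob_space (uniform_measure M {\<omega> \<in> space M. N t \<omega> = n})"
    using prob_count_pos[OF t, of n] by (intro prob_space_uniform_measure) (auto simp: emeasure_eq_measure)
  show "(\<lambda>\<omega>. path_max a (\<lambda>s. N s \<omega>) t) \<in>
      borel_measurable (uniform_measure M {\<omega> \<in> space M. N t \<omega> = n})"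
    using measurable_path_max_N[OF t] by simp
qed

lemma measure_max_law:
  assumes t: "0 < t" and B: "B \<in> sets borel"
  shows "measure (max_law a t n) B =
    prob {\<omega> \<in> space M. N t \<omega> = n \<and> path_max a (\<lambda>s. N s \<omega>) t \<in> B} / prob {\<omega> \<in> space M. N t \<omega> = n}"
proof -
  let ?X = "\<lambda>\<omega>. path_max a (\<lambda>s. N s \<omega>) t"
  have [measurable]: "?X \<in> borel_measurable M" by (rule measurable_path_max_N[OF t])
  have "measure (max_law a t n) B = measure (uniform_measure M {\<omega> \<in> space M. N t \<omega> = n}) (?X -` B \<inter> space M)"
    unfolding max_law_def using B by (subst measure_distr) auto
  also have "\<dots> = prob ({\<omega> \<in> space M. N t \<omega> = n} \<inter> (?X -` B \<inter> space M)) / prob {\<omega> \<in> space M. N t \<omega> = n}"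
    using prob_count_pos[OF t, of n] B
    by (intro measure_uniform_measure) (auto simp: emeasure_eq_measure intro: measurable_sets)
  also have "{\<omega> \<in> space M. N t \<omega> = n} \<inter> (?X -` B \<inter> space M) = {\<omega> \<in> space M. N t \<omega> = n \<and> ?X \<omega> \<in> B}"
    by auto
  finally show ?thesis .
qed

text \<open>Division by the Poisson probability cancels the exponential and the powers of the rate:
  the conditional law does not depend on the rate.\<close>

lemma max_law_tail:
  assumes "0 < c" "0 < \<beta>" "\<beta> < c * t" and "\<sigma> = 1 \<and> s = 0 \<or> \<sigma> = - 1 \<and> s = (1 :: int)"
  defines "y \<equiv> (t - \<beta> / c) / 2"
  shows "measure (max_law (of_int \<sigma> * c) t n) {\<beta><..} =
    fact n / t ^ n * wsum s n (\<lambda>i. (t - y) ^ i / fact i) (\<lambda>j. y ^ j / fact j)"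
proof -
  have t: "0 < t" using assms(1-3) by (metis less_trans zero_less_mult_pos)
  show ?thesis
    using prob_path_max_greater[OF assms(1-4), of n] rate t
    by (simp add: measure_max_law prob_count y_def power_mult_distrib)
qed

lemma max_law_recursion:
  assumes c: "0 < c" and t: "0 < t" and B: "B \<in> sets borel"
  shows "measure (max_law (- c) t (2 * k + 1)) B =
    (2 * real k + 1) / (2 * real k + 2) * measure (max_law (- c) t (2 * k)) B +
    1 / (2 * real k + 2) * measure (max_law c t (2 * k + 1)) B"
proof -
  let ?p = "(2 * real k + 1) / (2 * real k + 2)" and ?q = "1 / (2 * real k + 2)"
  have pq: "?p + ?q = 1" by (simp add: add_divide_distrib[symmetric])
  have pos: "measure (max_law (- c) t (2 * k + 1)) {x<..} =
      ?p * measure (max_law (- c) t (2 * k)) {x<..} + ?q * measure (max_law c t (2 * k + 1)) {x<..}"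
    if x: "0 < x" for x
  proof (cases "x < c * t")
    case True
    define y where "y = (t - x / c) / 2"
    define W where "W s n = wsum s n (\<lambda>i. (t - y) ^ i / fact i) (\<lambda>j. y ^ j / fact j)" for s n
    have down: "measure (max_law (- c) t n) {x<..} = fact n / t ^ n * W 1 n" for n
      using max_law_tail[OF c x True, of "- 1" 1 n] by (simp add: y_def W_def)
    have up: "measure (max_law c t n) {x<..} = fact n / t ^ n * W 0 n" for n
      using max_law_tail[OF c x True, of 1 0 n] by (simp add: y_def W_def)
    have "(2 * real k + 2) * W 1 (2 * k + 1) = t * W 1 (2 * k) + W 0 (2 * k + 1)"
      using wsum_power_identity[of k "t - y" y] by (simp add: W_def)
    then have W: "W 1 (2 * k + 1) = (t * W 1 (2 * k) + W 0 (2 * k + 1)) / (2 * real k + 2)"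
      by (simp add: field_simps)
    \<comment> \<open>The prefactor n!/t^n turns \<open>t * W 1 (2 * k)\<close> into 2k + 1 times
      the tail for 2k jumps; this is the origin of the numerator 2k + 1.\<close>
    have "fact (2 * k + 1) = (2 * real k + 1) * fact (2 * k)"
      by simp
    then show ?thesis
      unfolding down up W using t by (simp add: divide_simps) (simp add: algebra_simps)
  next
    case False
    have "measure (max_law a t n) {x<..} = 0" if "\<bar>a\<bar> = c" for a n
    proof -
      have "{\<omega> \<in> space M. N t \<omega> = n \<and> path_max a (\<lambda>s. N s \<omega>) t \<in> {x<..}} = {}"
        using path_max_le[OF mono_N, of _ t a] t False that by fastforce
      then show ?thesis by (subst measure_max_law[OF t]) (simp_all only: measure_empty, simp_all)
    qed
    then show ?thesis using c by simp
  qed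
  \<comment> \<open>The tail formula is available for positive levels only, and a path that starts
    downward may have maximum 0. The tail at 0 is therefore reached through levels decreasing to
    0.\<close>
  have zero: "measure (max_law (- c) t (2 * k + 1)) {0<..} =
      ?p * measure (max_law (- c) t (2 * k)) {0<..} + ?q * measure (max_law c t (2 * k + 1)) {0<..}"
  proof -
    have lim: "(\<lambda>i. measure (max_law a t n) {inverse (real (Suc i))<..}) \<longlonglongrightarrow> measure (max_law a t n) {0<..}" for a n
    proof -
      interpret L: prob_space "max_law a t n" by (rule prob_space_max_law[OF t])
      have "(\<Union>i. {inverse (real (Suc i))<..}) = {0<..}"
      proof (intro equalityI subsetI)
        fix x :: real assume "x \<in> (\<Union>i. {inverse (real (Suc i))<..})"
        then show "x \<in> {0<..}" by (auto intro: less_trans[rotated])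
      next
        fix x :: real assume "x \<in> {0<..}"
        then show "x \<in> (\<Union>i. {inverse (real (Suc i))<..})"
          using reals_Archimedean[of x] by auto
      qed
      moreover have "incseq (\<lambda>i. {inverse (real (Suc i))<..})"
        by (intro incseq_SucI) (auto simp: field_simps intro: le_less_trans[rotated])
      moreover have "range (\<lambda>i. {inverse (real (Suc i))<..}) \<subseteq> sets (max_law a t n)"
        by auto
      ultimately show ?thesis
        using L.finite_Lim_measure_incseq[of "\<lambda>i. {inverse (real (Suc i))<..}"] by (simp only:)
    qed
    show ?thesis
    proof (rule LIMSEQ_unique[OF lim])
      have "(\<lambda>i. ?p * measure (max_law (- c) t (2 * k)) {inverse (real (Suc i))<..} +
          ?q * measure (max_law c t (2 * k + 1)) {inverse (real (Suc i))<..})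
        \<longlonglongrightarrow> ?p * measure (max_law (- c) t (2 * k)) {0<..} + ?q * measure (max_law c t (2 * k + 1)) {0<..}"
        by (intro tendsto_add tendsto_mult tendsto_const lim)
      then show "(\<lambda>i. measure (max_law (- c) t (2 * k + 1)) {inverse (real (Suc i))<..})
        \<longlonglongrightarrow> ?p * measure (max_law (- c) t (2 * k)) {0<..} + ?q * measure (max_law c t (2 * k + 1)) {0<..}"
        by (subst pos) simp_all
    qed
  qed
  have neg: "measure (max_law a t n) {x<..} = 1" if "x < 0" for a n x
  proof -
    have "{\<omega> \<in> space M. N t \<omega> = n \<and> path_max a (\<lambda>s. N s \<omega>) t \<in> {x<..}} = {\<omega> \<in> space M. N t \<omega> = n}"
      using path_max_nonneg[OF mono_N, of _ t a] t that by fastforce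
    then show ?thesis
      using prob_count_pos[OF t, of n] by (subst measure_max_law[OF t]) simp_all
  qed
  show ?thesis
  proof (rule measure_combination_eqI[OF _ _ _ _ _ _ pq _ B])
    fix x :: real
    show "measure (max_law (- c) t (2 * k + 1)) {x<..} =
      ?p * measure (max_law (- c) t (2 * k)) {x<..} + ?q * measure (max_law c t (2 * k + 1)) {x<..}"
      using pos zero neg pq by (cases x "0 :: real" rule: linorder_cases) auto
  qed (simp_all add: prob_space_max_law[OF t])
qed

end

text \<open>Once V = a is fixed, independence contributes the same factor 1/2 to numerator and
  denominator, and only the condition on N(t) remains.\<close>

lemma telegraph_max_cond_prob:
  assumes "prob_space M" and rate: "rate > 0" and t: "t > 0"
    and data: "telegraph_data M c rate V N" and a: "a = c \<or> a = - c" and B: "B \<in> sets borel"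
  shows "\<P>(\<omega> in M. telegraph_max V N t \<omega> \<in> B \<bar> V \<omega> = a \<and> N t \<omega> = n) =
    measure (poisson.max_law M N a t n) B"
proof -
  interpret prob_space M by fact
  interpret poisson M rate N
    using rate data by unfold_locales (auto simp: telegraph_data_def)
  let ?F = "vimage_algebra (space M) (\<lambda>\<omega>. \<lambda>s\<in>{0..}. N s \<omega>) (PiM {0..} (\<lambda>_. count_space UNIV))"
  have half: "prob {\<omega> \<in> space M. V \<omega> = a} = 1 / 2"
    using data a by (auto simp: telegraph_data_def)
  have V: "{\<omega> \<in> space M. V \<omega> = a} \<in> sets (vimage_algebra (space M) V borel)"
  proof -
    have "{\<omega> \<in> space M. V \<omega> = a} = V -` {a} \<inter> space M" by auto
    then show ?thesis by (simp add: in_vimage_algebra)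
  qed
  have meas: "N s \<in> ?F \<rightarrow>\<^sub>M count_space UNIV" if "0 \<le> s" for s
  proof -
    have "(\<lambda>\<omega>. \<lambda>s\<in>{0..}. N s \<omega>) \<in> ?F \<rightarrow>\<^sub>M PiM {0..} (\<lambda>_. count_space UNIV)"
      by (rule measurable_vimage_algebra1) (auto simp: space_PiM)
    from measurable_compose[OF this measurable_component_singleton[of s]] that
    show ?thesis by simp
  qed
  have indep: "prob {\<omega> \<in> space M. V \<omega> = a \<and> N t \<omega> = n \<and> path_max a (\<lambda>s. N s \<omega>) t \<in> A} =
      1 / 2 * prob {\<omega> \<in> space M. N t \<omega> = n \<and> path_max a (\<lambda>s. N s \<omega>) t \<in> A}"
    if A: "A \<in> sets borel" for A
  proof -
    have [measurable]: "N t \<in> ?F \<rightarrow>\<^sub>M count_space UNIV" using meas t by simp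
    \<comment> \<open>Measurability with respect to the sigma-algebra of N itself is what
      \<open>indep_set\<close> asks for.\<close>
    have [measurable]: "(\<lambda>\<omega>. path_max a (\<lambda>s. N s \<omega>) t) \<in> borel_measurable ?F"
      by (rule measurable_path_max[OF meas t]) (auto intro: mono_N)
    note A[measurable]
    have "{\<omega> \<in> space ?F. N t \<omega> = n \<and> path_max a (\<lambda>s. N s \<omega>) t \<in> A} \<in> sets ?F"
      by measurable
    then have "prob ({\<omega> \<in> space M. V \<omega> = a} \<inter> {\<omega> \<in> space M. N t \<omega> = n \<and> path_max a (\<lambda>s. N s \<omega>) t \<in> A}) =
        prob {\<omega> \<in> space M. V \<omega> = a} * prob {\<omega> \<in> space M. N t \<omega> = n \<and> path_max a (\<lambda>s. N s \<omega>) t \<in> A}"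
      using data by (intro indep_setD[OF _ V]) (auto simp: telegraph_data_def)
    moreover have "{\<omega> \<in> space M. V \<omega> = a} \<inter> {\<omega> \<in> space M. N t \<omega> = n \<and> path_max a (\<lambda>s. N s \<omega>) t \<in> A} =
        {\<omega> \<in> space M. V \<omega> = a \<and> N t \<omega> = n \<and> path_max a (\<lambda>s. N s \<omega>) t \<in> A}"
      by auto
    ultimately show ?thesis by (simp add: half)
  qed
  have "{\<omega> \<in> space M. telegraph_max V N t \<omega> \<in> B \<and> V \<omega> = a \<and> N t \<omega> = n} =
      {\<omega> \<in> space M. V \<omega> = a \<and> N t \<omega> = n \<and> path_max a (\<lambda>s. N s \<omega>) t \<in> B}"
    by (auto simp: telegraph_max_eq_path_max)
  \<comment> \<open>The denominator is the case of the whole line.\<close>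
  moreover have "prob {\<omega> \<in> space M. V \<omega> = a \<and> N t \<omega> = n} = 1 / 2 * prob {\<omega> \<in> space M. N t \<omega> = n}"
    using indep[of UNIV] by simp
  ultimately show ?thesis
    unfolding cond_prob_def measure_max_law[OF t B] by (simp only: indep[OF B]) simp
qed

theorem mainTheorem9:
  fixes M :: "'a measure" and V :: "'a \<Rightarrow> real" and N :: "real \<Rightarrow> 'a \<Rightarrow> nat"
    and c rate t :: real and k :: nat and B :: "real set"
  assumes "prob_space M"
    and "c > 0" and "rate > 0" and "t > 0"
    and "telegraph_data M c rate V N"
    and "B \<in> sets borel" and "B \<subseteq> {0<..<c * t}"
  shows "\<P>(\<omega> in M. telegraph_max V N t \<omega> \<in> B \<bar> V \<omega> = - c \<and> N t \<omega> = 2 * k + 1)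
    = (2 * real k + 1) / (2 * real k + 2)
        * \<P>(\<omega> in M. telegraph_max V N t \<omega> \<in> B \<bar> V \<omega> = - c \<and> N t \<omega> = 2 * k)
    + 1 / (2 * real k + 2)
        * \<P>(\<omega> in M. telegraph_max V N t \<omega> \<in> B \<bar> V \<omega> = c \<and> N t \<omega> = 2 * k + 1)"
proof -
  interpret prob_space M by fact
  interpret poisson M rate N
    using assms by unfold_locales (auto simp: telegraph_data_def)
  note law = telegraph_max_cond_prob[OF assms(1,3,4,5) _ assms(6)]
  have "- c = c \<or> - c = - c" "c = c \<or> c = - c" by simp_all
  then show ?thesis
    unfolding law[of "- c", OF \<open>- c = c \<or> - c = - c\<close>] law[of c, OF \<open>c = c \<or> c = - c\<close>]
    by (intro max_law_recursion assms)
qed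

end
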